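(* Let $A\in\mathbb{R}^{n\times n}$, $n\ge1$, be a normal matrix, i.e. $A^TA=AA^T$, and let $\Lambda(A)\subseteq\mathbb{C}$ be its set of eigenvalues. Then $$\mathcal{G}^+(A)=\mathrm{Poly}\left(\Lambda(A)\cap\mathbb{C}^+\right).$$
   Context: Scaled relative graph. For $a,b\in\mathbb{R}^n$ let $\angle(a,b)=\arccos\left(\frac{a^Tb}{\|a\|\|b\|}\right)\in[0,\pi]$ if $a\neq0$ and $b\ne0$, and $\angle(a,b)=0$ otherwise, where $\|\cdot\|$ is the Euclidean norm. For $A\in\mathbb{R}^{n\times n}$ and nonzero $x\in\mathbb{R}^n$ define $$z_A(x)=\frac{\|Ax\|}{\|x\|}\exp[i\angle(Ax,x)]\in\mathbb{C}.$$ Let $\mathbb{C}^+=\{z\in\mathbb{C}:\mathrm{Im}\,z\ge0\}$. Then $z_A(x)\in\mathbb{C}^+$, and $\mathcal{G}^+(A)=\{z_A(x):x\in\mathbb{R}^n,\ x\ne0\}$ is the upper half of the scaled relative graph $\mathcal{G}(A)=\{z_A(x),\overline{z_A(x)}:x\in\mathbb{R}^n,\ x\neq0\}$. Arcs. For $z_1,z_2\in\mathbb{C}^+$ define $\mathrm{Arc}_{\min}(z_1,z_2)\subseteq\mathbb{C}^+$ as follows. If $\mathrm{Re}\,z_1\ne\mathrm{Re}\,z_2$, let $\mathrm{Circ}(z_1,z_2)$ be the unique circle through $z_1$ and $z_2$ with center on the real axis; $\mathrm{Arc}_{\min}(z_1,z_2)$ is the arc of $\mathrm{Circ}(z_1,z_2)$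 between $z_1$ and $z_2$ in the upper half-plane, i.e. the set of points of $\mathrm{Circ}(z_1,z_2)\cap\mathbb{C}^+$ whose real part lies between $\mathrm{Re}\,z_1$ and $\mathrm{Re}\,z_2$ (inclusive). If $\mathrm{Re}\,z_1=\mathrm{Re}\,z_2$ and $z_1\ne z_2$, then $\mathrm{Arc}_{\min}(z_1,z_2)$ is the line segment $[z_1,z_2]$. If $z_1=z_2$, then $\mathrm{Arc}_{\min}(z_1,z_2)=\{z_1\}$. Arc-edge polygon. For $m\ge1$ and $z_1,\dots,z_m\in\mathbb{C}^+$: if $m=1$, $\mathrm{Poly}(z_1)=\{z_1\}$; if $m\ge2$, let $S=\bigcup_{1\le i,j\le m}\mathrm{Arc}_{\min}(z_i,z_j)$ and $\mathrm{Poly}(z_1,\dots,z_m)=S\cup\{\text{region enclosed by }S\}$, where the region enclosed by $S$ is the union of all regions enclosed by Jordan curves (non-self-intersecting continuous loops) contained in $S$. For a finite nonempty set $Z=\{z_1,\dots,z_m\}\subseteq\mathbb{C}^+$, $\mathrm{Poly}(Z)$ means $\mathrm{Poly}(z_1,\dots,z_m)$ (this does not depend on the ordering). *)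

theory Defs
  imports "HOL-Analysis.Analysis"
begin

definition vec_angle :: "'a::real_inner \<Rightarrow> 'a \<Rightarrow> real" where
  "vec_angle a b =
     (if a \<noteq> 0 \<and> b \<noteq> 0 then arccos ((a \<bullet> b) / (norm a * norm b)) else 0)"

definition srg_point :: "real^'n^'n \<Rightarrow> real^'n \<Rightarrow> complex" where
  "srg_point A x =
     of_real (norm (A *v x) / norm x) * exp (\<i> * of_real (vec_angle (A *v x) x))"

definition upper_srg :: "real^'n^'n \<Rightarrow> complex set" where
  "upper_srg A = {srg_point A x | x. x \<noteq> 0}"

definition upper_half_plane :: "complex set" where
  "upper_half_plane = {z. Im z \<ge> 0}"

text \<open>The eigenvalues of a real matrix are taken over the complex numbers.\<close>

definition eigenvalues :: "real^'n^'n \<Rightarrow> complex set" where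
  "eigenvalues A =
     {l. \<exists>v :: complex^'n. v \<noteq> 0 \<and> map_matrix of_real A *v v = l *s v}"

definition real_centred_circle :: "complex set \<Rightarrow> bool" where
  "real_centred_circle C \<longleftrightarrow> (\<exists>(c::real) r. r > 0 \<and> C = sphere (of_real c) r)"

text \<open>Meaningful only for \<open>Re z1 \<noteq> Re z2\<close>; see \<open>ex1_circ\<close>.\<close>

definition circ :: "complex \<Rightarrow> complex \<Rightarrow> complex set" where
  "circ z1 z2 = (THE C. real_centred_circle C \<and> z1 \<in> C \<and> z2 \<in> C)"

lemma ex1_circ:
  assumes "Re z1 \<noteq> Re z2"
  shows "\<exists>!C. real_centred_circle C \<and> z1 \<in> C \<and> z2 \<in> C"
proof -
  define c where "c = ((Re z1)\<^sup>2 + (Im z1)\<^sup>2 - (Re z2)\<^sup>2 - (Im z2)\<^sup>2) / (2 * (Re z1 - Re z2))"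
  have eq: "dist (of_real d) z1 = dist (of_real d) z2 \<longleftrightarrow> d = c" for d :: real
  proof -
    have "dist (of_real d) z1 = dist (of_real d) z2 \<longleftrightarrow>
          (dist (of_real d) z1)\<^sup>2 = (dist (of_real d) z2)\<^sup>2"
      by simp
    also have "\<dots> \<longleftrightarrow> (d - Re z1)\<^sup>2 + (Im z1)\<^sup>2 = (d - Re z2)\<^sup>2 + (Im z2)\<^sup>2"
      by (simp add: dist_norm cmod_power2)
    also have "\<dots> \<longleftrightarrow> d = c"
      using assms unfolding c_def
      by (auto simp: field_simps power2_diff)
    finally show ?thesis .
  qed
  have pos: "dist (of_real c) z1 > 0"
    using assms eq[of c] by (metis dist_eq_0_iff zero_less_dist_iff)
  show ?thesis
  proof (rule ex1I[of _ "sphere (of_real c) (dist (of_real c) z1)"])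
    show "real_centred_circle (sphere (of_real c) (dist (of_real c) z1)) \<and>
          z1 \<in> sphere (of_real c) (dist (of_real c) z1) \<and>
          z2 \<in> sphere (of_real c) (dist (of_real c) z1)"
      unfolding real_centred_circle_def
      using pos eq[of c] by (metis mem_sphere)
  next
    fix C assume "real_centred_circle C \<and> z1 \<in> C \<and> z2 \<in> C"
    then show "C = sphere (of_real c) (dist (of_real c) z1)"
      unfolding real_centred_circle_def using eq by fastforce
  qed
qed

definition arc_min :: "complex \<Rightarrow> complex \<Rightarrow> complex set" where
  "arc_min z1 z2 =
     (if Re z1 \<noteq> Re z2 then
        {w \<in> circ z1 z2 \<inter> upper_half_plane.
           min (Re z1) (Re z2) \<le> Re w \<and> Re w \<le> max (Re z1) (Re z2)}
      else if z1 \<noteq> z2 then closed_segment z1 z2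
      else {z1})"

text \<open>A Jordan curve is a closed \<^const>\<open>simple_path\<close>; the region it encloses is the
  \<^const>\<open>inside\<close> of its image.\<close>

definition enclosed_region :: "complex set \<Rightarrow> complex set" where
  "enclosed_region S =
     \<Union> {inside (path_image g) | g.
          simple_path g \<and> pathfinish g = pathstart g \<and> path_image g \<subseteq> S}"

text \<open>The polygon is defined on the set of its vertices, on which alone the union of arcs
  over all pairs of indices depends. Intended for finite nonempty subsets of
  \<^const>\<open>upper_half_plane\<close>.\<close>

definition arc_edges :: "complex set \<Rightarrow> complex set" where
  "arc_edges Z = (\<Union>z1\<in>Z. \<Union>z2\<in>Z. arc_min z1 z2)"

definition arc_poly :: "complex set \<Rightarrow> complex set" where
  "arc_poly Z =
     (if card Z = 1 then Z else arc_edges Z \<union> enclosed_region (arc_edges Z))"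

end

theory Submission
  imports Defs
begin

text \<open>In the coordinates \<open>(Re z, |z|\<^sup>2)\<close> on the upper half-plane, circles with real centre
  and vertical lines become straight lines, so an arc-edge polygon becomes the union of
  all segments between its vertices together with the regions enclosed by them. By
  Caratheodory's theorem, and since triangles are bounded by Jordan curves, this is the convex
  hull of the vertices. In the same coordinates the scaled relative graph is
  \<open>{(x \<bullet> A x, |A x|\<^sup>2) : |x| = 1}\<close>. For normal \<open>A\<close> the commuting symmetric matrices
  \<open>A + A\<^sup>T\<close> and \<open>A\<^sup>T A\<close> have a common orthonormal eigenbasis, whose pairs of eigenvalues
  \<open>(2 Re \<lambda>, |\<lambda>|\<^sup>2)\<close> come from eigenvalues \<open>\<lambda>\<close> of \<open>A\<close>. So this set is the convex hull of
  the points \<open>(Re \<lambda>, |\<lambda>|\<^sup>2)\<close>.\<close>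

section \<open>Planar polygons and enclosed regions\<close>

text \<open>Components of the complement of \<open>S\<close> go to components of the complement of
  the image. A bounded one has compact closure, and \<open>f\<close> is continuous on the whole
  space, so its image stays bounded.\<close>

lemma inside_homeomorphism:
  fixes f :: "'a::heine_borel \<Rightarrow> 'b::heine_borel"
  assumes "homeomorphism UNIV UNIV f g"
  shows "f ` inside S \<subseteq> inside (f ` S)"
proof
  fix w assume "w \<in> f ` inside S"
  then obtain x where w: "w = f x" and x: "x \<notin> S"
    and bd: "bounded (connected_component_set (- S) x)"
    by (auto simp: inside_def)
  have "inj f"
    using assms by (metis homeomorphism_apply1 injI UNIV_I)
  moreover have "f ` UNIV = UNIV"
    using assms by (simp add: homeomorphism_def)
  ultimately have "f ` (- S) = - f ` S"
    by (metis bij_image_Compl_eq bij_def)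
  moreover have "homeomorphism (- S) (f ` (- S)) f g"
    using homeomorphism_of_subsets[OF assms] by blast
  ultimately have *: "connected_component_set (- f ` S) (f x) = f ` connected_component_set (- S) x"
    using connected_component_set_homeomorphism[of "- S" "- f ` S" f g x] x by simp
  have "bounded (f ` connected_component_set (- S) x)"
  proof (rule bounded_subset)
    have "continuous_on UNIV f"
      using assms by (simp add: homeomorphism_def)
    then show "bounded (f ` closure (connected_component_set (- S) x))"
      using bd by (intro compact_imp_bounded compact_continuous_image)
        (auto simp: compact_eq_bounded_closed intro: continuous_on_subset)
  qed (use closure_subset in blast)
  then show "w \<in> inside (f ` S)"
    using x \<open>inj f\<close> by (auto simp: inside_def w * inj_image_mem_iff)
qed

lemma enclosed_regionI:
  assumes "simple_path p" "pathfinish p = pathstart p" "path_image p \<subseteq> S"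
    and "x \<in> inside (path_image p)"
  shows "x \<in> enclosed_region S"
  unfolding enclosed_region_def
  by (rule UnionI[OF _ assms(4)]) (use assms in auto)

text \<open>A Jordan curve in \<open>S\<close> is composed with \<open>f\<close>, and its inside
  moves along by \<open>inside_homeomorphism\<close>.\<close>

lemma enclosed_region_homeomorphism_subset:
  assumes hom: "homeomorphism UNIV UNIV f g"
  shows "f ` enclosed_region S \<subseteq> enclosed_region (f ` S)"
proof
  fix w assume "w \<in> f ` enclosed_region S"
  then obtain p where w: "w \<in> f ` inside (path_image p)" and p: "simple_path p"
    "pathfinish p = pathstart p" "path_image p \<subseteq> S"
    by (auto simp: enclosed_region_def)
  have "continuous_on (path_image p) f" "inj_on f (path_image p)"
    using hom by (auto simp: homeomorphism_def intro: continuous_on_subset inj_on_inverseI)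
  then have "simple_path (f \<circ> p)"
    using p simple_path_continuous_image by blast
  moreover have "pathfinish (f \<circ> p) = pathstart (f \<circ> p)" "path_image (f \<circ> p) \<subseteq> f ` S"
    using p by (auto simp: pathfinish_def pathstart_def path_image_def)
  moreover have "w \<in> inside (path_image (f \<circ> p))"
    using w inside_homeomorphism[OF hom, of "path_image p"] by (auto simp: path_image_compose)
  ultimately show "w \<in> enclosed_region (f ` S)"
    by (rule enclosed_regionI)
qed

lemma enclosed_region_homeomorphism:
  assumes hom: "homeomorphism UNIV UNIV f g"
  shows "enclosed_region (f ` S) = f ` enclosed_region S"
proof
  have gf: "g (f z) = z" and fg: "f (g z) = z" for z
    using hom by (auto simp: homeomorphism_def)
  have "g ` enclosed_region (f ` S) \<subseteq> enclosed_region (g ` f ` S)"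
    using enclosed_region_homeomorphism_subset[of g f] hom homeomorphism_sym by blast
  then have "f ` g ` enclosed_region (f ` S) \<subseteq> f ` enclosed_region (g ` f ` S)"
    by (rule image_mono)
  then show "enclosed_region (f ` S) \<subseteq> f ` enclosed_region S"
    by (simp add: image_image fg gf)
qed (rule enclosed_region_homeomorphism_subset[OF hom])

text \<open>Two sides of a nondegenerate triangle meet only in their common vertex.\<close>

lemma simple_path_triangle:
  fixes a b c :: "'a::euclidean_space"
  assumes "\<not> collinear {a, b, c}"
  shows "simple_path (linepath a b +++ linepath b c +++ linepath c a)"
proof -
  have ne: "a \<noteq> b" "b \<noteq> c" "c \<noteq> a"
    using assms by (auto simp: insert_commute)
  have "arc (linepath b c +++ linepath c a)"
  proof (rule arc_join)
    have "closed_segment b c \<inter> closed_segment c a = {c}"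
      using assms by (intro Int_closed_segment) (auto simp: insert_commute)
    then show "path_image (linepath b c) \<inter> path_image (linepath c a)
        \<subseteq> {pathstart (linepath c a)}"
      by simp
  qed (use ne in auto)
  moreover have "closed_segment a b \<inter> (closed_segment b c \<union> closed_segment c a) \<subseteq> {a, b}"
  proof -
    have "closed_segment a b \<inter> closed_segment b c = {b}"
      using assms by (intro Int_closed_segment) auto
    moreover have "closed_segment c a \<inter> closed_segment a b = {a}"
      using assms by (intro Int_closed_segment) (auto simp: insert_commute)
    ultimately show ?thesis by blast
  qed
  ultimately show ?thesis
    using ne by (intro simple_path_join_loop arc_linepath) (auto simp: path_image_join)
qed

text \<open>One of three collinear points lies between the other two, so the hull is the segment
  joining those two.\<close>

lemma convex_hull_3_collinear:
  fixes a b c :: "'a::euclidean_space"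
  assumes "collinear {a, b, c}"
  shows "convex hull {a, b, c} \<subseteq> closed_segment a b \<union> closed_segment b c \<union> closed_segment c a"
proof -
  have *: "convex hull {p, q, r} \<subseteq> closed_segment q r" if "p \<in> closed_segment q r" for p q r :: 'a
    using that by (intro hull_minimal) auto
  show ?thesis
  proof -
    have "{b, c, a} = {a, b, c}" "{c, a, b} = {a, b, c}"
      by auto
    moreover have "a \<in> closed_segment b c \<or> b \<in> closed_segment c a \<or> c \<in> closed_segment a b"
      using assms by (simp add: collinear_between_cases between_mem_segment)
    ultimately show ?thesis
      using *[of a b c] *[of b c a] *[of c a b] by auto
  qed
qed

text \<open>The complement of a convex set lies outside every curve within the set, so enclosed
  regions stay in the hull. Conversely, a point of the hull lies in a triangle with vertices in
  \<open>P\<close>: on a side, or enclosed by the boundary.\<close>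

lemma convex_hull_eq_segments_enclosed:
  fixes P :: "complex set"
  defines "S \<equiv> \<Union>p\<in>P. \<Union>q\<in>P. closed_segment p q"
  shows "convex hull P = S \<union> enclosed_region S"
proof
  have S: "S \<subseteq> convex hull P"
    unfolding S_def by (intro UN_least closed_segment_subset convex_convex_hull hull_inc)
  moreover have "enclosed_region S \<subseteq> convex hull P"
  proof
    fix x assume "x \<in> enclosed_region S"
    then obtain g where g: "path_image g \<subseteq> S" "x \<in> inside (path_image g)"
      unfolding enclosed_region_def by blast
    have "- (convex hull P) \<subseteq> outside (path_image g)"
      using S g(1) by (intro outside_subset_convex) auto
    then show "x \<in> convex hull P"
      using g(2) inside_Int_outside[of "path_image g"] by blast
  qed
  ultimately show "S \<union> enclosed_region S \<subseteq> convex hull P"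
    by blast
  show "convex hull P \<subseteq> S \<union> enclosed_region S"
  proof
    fix x assume "x \<in> convex hull P"
    then obtain T where T: "finite T" "T \<subseteq> P" "card T \<le> 3" "x \<in> convex hull T"
      by (auto simp: caratheodory[of P] eval_nat_numeral)
    then obtain t where "t \<in> T"
      by fastforce
    \<comment> \<open>Repetitions among the three vertices are allowed. They make the triangle
      collinear, and then \<open>x\<close> lies on a side.\<close>
    have "\<exists>a\<in>T. \<exists>b\<in>T. \<exists>c\<in>T. T = {a, b, c}"
    proof -
      have "card T = 0 \<or> card T = 1 \<or> card T = 2 \<or> card T = 3"
        using T(3) by linarith
      then show ?thesis
        using T(1) \<open>t \<in> T\<close> by (auto simp: card_1_singleton_iff card_2_iff card_3_iff)
    qed
    then obtain a b c where abc: "a \<in> P" "b \<in> P" "c \<in> P" and x: "x \<in> convex hull {a, b, c}"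
      using T by blast
    let ?D = "closed_segment a b \<union> closed_segment b c \<union> closed_segment c a"
    have DS: "?D \<subseteq> S"
      using abc by (auto simp: S_def)
    show "x \<in> S \<union> enclosed_region S"
    proof (cases "x \<in> ?D")
      case False
      have D: "path_image (linepath a b +++ linepath b c +++ linepath c a) = ?D"
        by (simp add: path_image_join Un_assoc)
      have "\<not> collinear {a, b, c}"
        using False x convex_hull_3_collinear by blast
      then have "simple_path (linepath a b +++ linepath b c +++ linepath c a)"
        by (rule simple_path_triangle)
      moreover have "x \<in> inside (path_image (linepath a b +++ linepath b c +++ linepath c a))"
        unfolding D using False x by (simp add: inside_of_triangle interior_of_triangle)
      moreover have "path_image (linepath a b +++ linepath b c +++ linepath c a) \<subseteq> S"
        unfolding D by (rule DS)
      ultimately have "x \<in> enclosed_region S"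
        by (intro enclosed_regionI) simp_all
      then show ?thesis ..
    qed (use DS in blast)
  qed
qed

section \<open>Straightening real-centred circles\<close>

text \<open>On the upper half-plane the chart is \<open>z \<mapsto> (Re z, |z|\<^sup>2)\<close>, which turns the equation
  of a circle with real centre into that of a line; the sign of \<open>Im z\<close> is
  built in to obtain a homeomorphism of the whole plane.\<close>

definition chart :: "complex \<Rightarrow> complex" where
  "chart z = Complex (Re z) ((Re z)\<^sup>2 + Im z * \<bar>Im z\<bar>)"

text \<open>The real \<open>sqrt\<close> is an odd function on the whole line, so it inverts the
  signed square for negative arguments too.\<close>

definition chart_inv :: "complex \<Rightarrow> complex" where
  "chart_inv w = Complex (Re w) (sqrt (Im w - (Re w)\<^sup>2))"

lemma Re_chart [simp]: "Re (chart z) = Re z"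
  by (simp add: chart_def)

lemma chart_upper: "Im z \<ge> 0 \<Longrightarrow> chart z = Complex (Re z) ((cmod z)\<^sup>2)"
  by (simp add: chart_def cmod_power2) (simp add: power2_eq_square)

lemma sqrt_signed_square: "sqrt (a * \<bar>a\<bar>) = a"
  by (cases "a \<ge> 0") (auto simp: real_sqrt_minus)

lemma signed_square_sqrt: "sqrt a * \<bar>sqrt a\<bar> = a"
  by (cases "a \<ge> 0") auto

lemma homeomorphism_chart: "homeomorphism UNIV UNIV chart chart_inv"
proof (rule homeomorphismI)
  show "continuous_on UNIV chart" "continuous_on UNIV chart_inv"
    unfolding chart_def chart_inv_def by (intro continuous_intros)+
  show "chart_inv (chart z) = z" for z
    by (simp add: chart_def chart_inv_def sqrt_signed_square)
  show "chart (chart_inv w) = w" for w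
    by (simp add: chart_def chart_inv_def signed_square_sqrt)
qed auto

lemma inj_chart: "inj chart"
  using homeomorphism_chart by (metis homeomorphism_apply1 injI UNIV_I)

text \<open>On a non-vertical line the real part parametrizes the segment. This is the form in which
  \<open>arc_min\<close> cuts an arc out of a circle.\<close>

lemma closed_segment_Re_neq:
  assumes "Re a \<noteq> Re b" "Im a = m * Re a + k" "Im b = m * Re b + k"
  shows "w \<in> closed_segment a b \<longleftrightarrow>
    min (Re a) (Re b) \<le> Re w \<and> Re w \<le> max (Re a) (Re b) \<and> Im w = m * Re w + k"
proof
  assume "w \<in> closed_segment a b"
  then obtain u where u: "0 \<le> u" "u \<le> 1" "w = (1 - u) *\<^sub>R a + u *\<^sub>R b"
    by (auto simp: in_segment)
  have "Re w \<in> closed_segment (Re a) (Re b)"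
    using u by (auto simp: in_segment)
  moreover have "Im w = m * Re w + k"
    unfolding u(3) by (simp add: assms algebra_simps)
  ultimately show "min (Re a) (Re b) \<le> Re w \<and> Re w \<le> max (Re a) (Re b) \<and> Im w = m * Re w + k"
    by (auto simp: closed_segment_eq_real_ivl split: if_splits)
next
  assume w: "min (Re a) (Re b) \<le> Re w \<and> Re w \<le> max (Re a) (Re b) \<and> Im w = m * Re w + k"
  then have "Re w \<in> closed_segment (Re a) (Re b)"
    by (auto simp: closed_segment_eq_real_ivl)
  then obtain u where u: "0 \<le> u" "u \<le> 1" "Re w = (1 - u) * Re a + u * Re b"
    by (auto simp: in_segment)
  have "Im w = m * ((1 - u) * Re a + u * Re b) + k"
    using w u(3) by simp
  then have "Im w = (1 - u) * Im a + u * Im b"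
    by (simp add: assms algebra_simps)
  then show "w \<in> closed_segment a b"
    using u by (auto simp: in_segment complex_eq_iff)
qed

lemma circ_eq_sphere:
  assumes "Re z1 \<noteq> Re z2"
  obtains c r where "r > 0" "circ z1 z2 = sphere (of_real c) r"
    "z1 \<in> sphere (of_real c) r" "z2 \<in> sphere (of_real c) r"
proof -
  have C: "real_centred_circle (circ z1 z2) \<and> z1 \<in> circ z1 z2 \<and> z2 \<in> circ z1 z2"
    unfolding circ_def by (rule theI'[OF ex1_circ[OF assms]])
  then obtain c r where "r > 0" "circ z1 z2 = sphere (of_real c) r"
    unfolding real_centred_circle_def by blast
  with C show thesis
    by (intro that[of r c]) simp_all
qed

text \<open>Since \<open>c\<close> is real, expanding the squared distance leaves
  \<open>Im z\<close> only inside the squared modulus of \<open>z\<close>, and the equation is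
  affine in the chart.\<close>

lemma mem_sphere_real_centre_iff:
  assumes "r > 0" "Im z \<ge> 0"
  shows "z \<in> sphere (of_real c) r \<longleftrightarrow> Im (chart z) = 2 * c * Re (chart z) + (r\<^sup>2 - c\<^sup>2)"
proof -
  have "z \<in> sphere (of_real c) r \<longleftrightarrow> (dist (of_real c) z)\<^sup>2 = r\<^sup>2"
    using assms by simp
  also have "\<dots> \<longleftrightarrow> (c - Re z)\<^sup>2 + (Im z)\<^sup>2 = r\<^sup>2"
    by (simp add: dist_norm cmod_power2)
  also have "\<dots> \<longleftrightarrow> Im (chart z) = 2 * c * Re (chart z) + (r\<^sup>2 - c\<^sup>2)"
    using assms by (auto simp: chart_def power2_eq_square algebra_simps)
  finally show ?thesis .
qed

lemma upper_half_plane_chart: "z \<in> upper_half_plane \<longleftrightarrow> (Re (chart z))\<^sup>2 \<le> Im (chart z)"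
  by (auto simp: upper_half_plane_def chart_def zero_le_mult_iff)

text \<open>This region is the chart image of the upper half-plane. Its convexity keeps segments
  between chart points inside that image.\<close>

lemma convex_epigraph_square: "convex {w. (Re w)\<^sup>2 \<le> Im w}"
proof (rule convexI)
  fix x y :: complex and u v :: real
  assume xy: "x \<in> {w. (Re w)\<^sup>2 \<le> Im w}" "y \<in> {w. (Re w)\<^sup>2 \<le> Im w}"
    and uv: "0 \<le> u" "0 \<le> v" "u + v = 1"
  have "(u * Re x + v * Re y)\<^sup>2 \<le> u * (Re x)\<^sup>2 + v * (Re y)\<^sup>2"
  proof -
    have u: "u = 1 - v"
      using uv by simp
    show ?thesis
      using convex_onD[OF convex_power2, of v "Re x" "Re y"] uv(1,2) by (simp add: u)
  qed
  also have "\<dots> \<le> u * Im x + v * Im y"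
    using xy uv by (intro add_mono mult_left_mono) auto
  finally show "u *\<^sub>R x + v *\<^sub>R y \<in> {w. (Re w)\<^sup>2 \<le> Im w}"
    by simp
qed

lemma chart_arc_min:
  assumes "z1 \<in> upper_half_plane" "z2 \<in> upper_half_plane"
  shows "chart ` arc_min z1 z2 = closed_segment (chart z1) (chart z2)"
proof -
  have "z \<in> arc_min z1 z2 \<longleftrightarrow> chart z \<in> closed_segment (chart z1) (chart z2)" for z
  proof (cases "Re z1 = Re z2")
    case True
    \<comment> \<open>A segment with equal endpoints is a singleton, so the last two cases of
      \<open>arc_min\<close> merge.\<close>
    have arc: "arc_min z1 z2 = closed_segment z1 z2"
      using True by (auto simp: arc_min_def)
    \<comment> \<open>On a vertical line the chart is the signed square of \<open>Im z\<close> up to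
      a constant. Being strictly increasing, it maps segments to segments.\<close>
    have mono: "a * \<bar>a\<bar> \<le> b * \<bar>b\<bar> \<longleftrightarrow> a \<le> b" for a b :: real
      using real_sqrt_le_iff[of "a * \<bar>a\<bar>" "b * \<bar>b\<bar>"] by (simp only: sqrt_signed_square)
    show ?thesis
      using True mono by (auto simp: arc closed_segment_same_Re closed_segment_eq_real_ivl chart_def)
  next
    case False
    then obtain c r where cr: "r > 0" "circ z1 z2 = sphere (of_real c) r"
      "z1 \<in> sphere (of_real c) r" "z2 \<in> sphere (of_real c) r"
      by (rule circ_eq_sphere)
    have up: "Im z1 \<ge> 0" "Im z2 \<ge> 0"
      using assms by (auto simp: upper_half_plane_def)
    \<comment> \<open>The line equation describes the circle only in the upper half-plane, so
      preimages of segment points must first be placed there.\<close>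
    have "closed_segment (chart z1) (chart z2) \<subseteq> {w. (Re w)\<^sup>2 \<le> Im w}"
      using assms convex_epigraph_square
      by (intro closed_segment_subset) (auto simp only: upper_half_plane_chart mem_Collect_eq)
    then have "z \<in> upper_half_plane" if "chart z \<in> closed_segment (chart z1) (chart z2)"
      using that upper_half_plane_chart by blast
    moreover have "chart z \<in> closed_segment (chart z1) (chart z2) \<longleftrightarrow>
        min (Re z1) (Re z2) \<le> Re z \<and> Re z \<le> max (Re z1) (Re z2) \<and>
        Im (chart z) = 2 * c * Re (chart z) + (r\<^sup>2 - c\<^sup>2)"
      using closed_segment_Re_neq[of "chart z1" "chart z2" "2 * c" "r\<^sup>2 - c\<^sup>2"]
        mem_sphere_real_centre_iff[OF cr(1)] up cr(3,4) False by simp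
    moreover have "z \<in> sphere (of_real c) r \<longleftrightarrow> Im (chart z) = 2 * c * Re (chart z) + (r\<^sup>2 - c\<^sup>2)"
      if "z \<in> upper_half_plane"
      using mem_sphere_real_centre_iff[OF cr(1)] that by (simp add: upper_half_plane_def)
    ultimately show ?thesis
      using False cr(2) by (auto simp: arc_min_def)
  qed
  moreover have chart_chart_inv: "chart (chart_inv w) = w" for w
    using homeomorphism_chart by (simp add: homeomorphism_def)
  then have "w \<in> chart ` S \<longleftrightarrow> chart_inv w \<in> S" for w S
    using inj_image_mem_iff[OF inj_chart] by metis
  ultimately show ?thesis
    by (simp add: set_eq_iff chart_chart_inv)
qed

lemma chart_arc_poly:
  assumes "Z \<subseteq> upper_half_plane"
  shows "chart ` arc_poly Z = convex hull (chart ` Z)"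
proof (cases "card Z = 1")
  case True
  then show ?thesis
    by (auto simp: arc_poly_def card_1_singleton_iff)
next
  case False
  have "chart ` arc_edges Z = (\<Union>z1\<in>Z. \<Union>z2\<in>Z. chart ` arc_min z1 z2)"
    by (simp add: arc_edges_def image_UN)
  also have "\<dots> = (\<Union>z1\<in>Z. \<Union>z2\<in>Z. closed_segment (chart z1) (chart z2))"
    using assms by (intro SUP_cong refl chart_arc_min) auto
  finally show ?thesis
    using False
    by (simp add: arc_poly_def image_Un convex_hull_eq_segments_enclosed
        flip: enclosed_region_homeomorphism[OF homeomorphism_chart])
qed

section \<open>Commuting self-adjoint operators\<close>

text \<open>The eigenvector maximizes the Rayleigh quotient on the unit sphere of \<open>V\<close>.\<close>

lemma self_adjoint_eigenvector:
  fixes f :: "'a::euclidean_space \<Rightarrow> 'a"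
  assumes f: "linear f" and sym: "\<And>x y. f x \<bullet> y = x \<bullet> f y"
    and V: "subspace V" "f ` V \<subseteq> V" "V \<noteq> {0}"
  obtains v c where "v \<in> V" "norm v = 1" "f v = c *\<^sub>R v"
proof -
  interpret f: linear f by fact
  have "0 \<in> V"
    using V(1) by (rule subspace_0)
  with V(3) obtain w where w: "w \<in> V" "w \<noteq> 0"
    by blast
  have "compact (V \<inter> sphere 0 1)"
    using V(1) by (simp add: closed_subspace closed_Int_compact)
  moreover have "V \<inter> sphere 0 1 \<noteq> {}"
  proof -
    have "w /\<^sub>R norm w \<in> V \<inter> sphere 0 1"
      using w V(1) by (simp add: subspace_scale)
    then show ?thesis by blast
  qed
  moreover have "continuous_on (V \<inter> sphere 0 1) (\<lambda>x. x \<bullet> f x)"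
    using f by (intro continuous_intros linear_continuous_on linear_conv_bounded_linear[THEN iffD1])
  ultimately have "\<exists>v\<in>V \<inter> sphere 0 1. \<forall>x\<in>V \<inter> sphere 0 1. x \<bullet> f x \<le> v \<bullet> f v"
    by (rule continuous_attains_sup)
  then obtain v where v: "v \<in> V" "norm v = 1"
    and max: "\<And>x. x \<in> V \<Longrightarrow> norm x = 1 \<Longrightarrow> x \<bullet> f x \<le> v \<bullet> f v"
    by auto
  define m where "m = v \<bullet> f v"
  define d where "d = m *\<^sub>R v - f v"
  have dV: "d \<in> V"
    using v V by (auto simp: d_def intro!: subspace_diff subspace_scale)
  \<comment> \<open>The bound on unit vectors extends to \<open>V\<close> by homogeneity.\<close>
  have psd: "x \<bullet> f x \<le> m * (x \<bullet> x)" if "x \<in> V" for x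
  proof (cases "x = 0")
    case False
    have "(x /\<^sub>R norm x) \<bullet> f (x /\<^sub>R norm x) \<le> m"
      using max[of "x /\<^sub>R norm x"] that False V(1) by (simp add: m_def subspace_scale)
    then show ?thesis
      using False by (simp add: f.scaleR field_simps flip: power2_norm_eq_inner power2_eq_square)
  qed (simp add: f.zero)
  \<comment> \<open>The form in \<open>psd\<close>, right side minus left side, is nonnegative and
    vanishes at \<open>v\<close>. Moving from \<open>v\<close> in direction \<open>d\<close>, its
    linear term is twice \<open>d \<bullet> d\<close>, which must therefore vanish.\<close>
  have quad: "0 \<le> 2 * t * (d \<bullet> d) + t\<^sup>2 * (m * (d \<bullet> d) - d \<bullet> f d)" for t
  proof -
    have "v + t *\<^sub>R d \<in> V"
      using v dV V(1) by (simp add: subspace_add subspace_scale)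
    from psd[OF this] have "0 \<le> m * ((v + t *\<^sub>R d) \<bullet> (v + t *\<^sub>R d)) - (v + t *\<^sub>R d) \<bullet> f (v + t *\<^sub>R d)"
      by simp
    also have "\<dots> = m * (v \<bullet> v) - v \<bullet> f v + 2 * t * (m * (v \<bullet> d) - f v \<bullet> d)
        + t\<^sup>2 * (m * (d \<bullet> d) - d \<bullet> f d)"
      using sym[of v d] by (simp add: f.add f.scaleR inner_add algebra_simps inner_commute power2_eq_square)
    also have "m * (v \<bullet> v) - v \<bullet> f v = 0"
      using v by (simp add: m_def flip: power2_norm_eq_inner)
    also have "m * (v \<bullet> d) - f v \<bullet> d = d \<bullet> d"
      using inner_diff_left[of "m *\<^sub>R v" "f v" d] by (simp flip: d_def)
    finally show ?thesis by simp
  qed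
  have "d \<bullet> d = 0"
  proof (rule ccontr)
    define a where "a = d \<bullet> d"
    \<comment> \<open>An upper bound for the quadratic coefficient, made positive by the added 1. At
      \<open>t = - (a / b)\<close> the linear term then outweighs the quadratic one.\<close>
    define b where "b = \<bar>m * (d \<bullet> d) - d \<bullet> f d\<bar> + 1"
    assume "d \<bullet> d \<noteq> 0"
    then have a: "a > 0"
      by (simp add: a_def)
    have b: "b > 0" "m * (d \<bullet> d) - d \<bullet> f d \<le> b"
      by (auto simp: b_def)
    have "0 \<le> 2 * (- (a / b)) * a + (a / b)\<^sup>2 * b"
      using quad[of "- (a / b)"] mult_left_mono[OF b(2), of "(a / b)\<^sup>2"]
      by (simp add: a_def)
    also have "\<dots> = - (a\<^sup>2 / b)"
      using b by (simp add: field_simps power2_eq_square)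
    finally show False
      using divide_pos_pos[OF zero_less_power[OF a, of 2] b(1)] by linarith
  qed
  then have "f v = m *\<^sub>R v"
    by (simp add: d_def)
  with v show thesis
    by (rule that)
qed

text \<open>Induction on the dimension. By commutation an eigenspace of \<open>f\<close> is
  invariant under \<open>g\<close>, so it contains an eigenvector of \<open>g\<close>, common to
  both. By self-adjointness the orthogonal complement of that vector in \<open>V\<close> is
  invariant under both maps.\<close>

lemma commuting_self_adjoint_eigenbasis:
  fixes f g :: "'a::euclidean_space \<Rightarrow> 'a"
  assumes f: "linear f" "\<And>x y. f x \<bullet> y = x \<bullet> f y"
    and g: "linear g" "\<And>x y. g x \<bullet> y = x \<bullet> g y"
    and comm: "\<And>x. f (g x) = g (f x)"
    and "subspace V" "f ` V \<subseteq> V" "g ` V \<subseteq> V"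
  shows "\<exists>B. pairwise orthogonal B \<and> (\<forall>b\<in>B. norm b = 1) \<and> span B = V \<and>
           (\<forall>b\<in>B. \<exists>c d. f b = c *\<^sub>R b \<and> g b = d *\<^sub>R b)"
  using assms(6-)
proof (induction "dim V" arbitrary: V rule: less_induct)
  case less
  note V = less.prems
  interpret f: linear f by fact
  interpret g: linear g by fact
  show ?case
  proof (cases "V = {0}")
    case True
    then show ?thesis
      by (intro exI[of _ "{}"]) auto
  next
    case False
    obtain v0 c where v0: "v0 \<in> V" "norm v0 = 1" "f v0 = c *\<^sub>R v0"
      by (rule self_adjoint_eigenvector[OF f V(1,2) False])
    define E where "E = {x\<in>V. f x = c *\<^sub>R x}"
    have "subspace E"
      using V(1) by (auto simp: E_def subspace_def f.zero f.add f.scaleR algebra_simps)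
    moreover have "g ` E \<subseteq> E"
      using V(3) by (auto simp: E_def comm g.scaleR)
    moreover have "E \<noteq> {0}"
    proof -
      have "v0 \<in> E" "v0 \<noteq> 0"
        using v0 by (simp add: E_def, force)
      then show ?thesis by blast
    qed
    ultimately obtain v d where v: "v \<in> E" "norm v = 1" "g v = d *\<^sub>R v"
      by (rule self_adjoint_eigenvector[OF g])
    have v': "v \<in> V" "f v = c *\<^sub>R v" "v \<bullet> v = 1"
      using v by (auto simp: E_def simp flip: power2_norm_eq_inner)
    define W where "W = {x\<in>V. v \<bullet> x = 0}"
    have subW: "subspace W"
      using V(1) by (auto simp: W_def subspace_def inner_add)
    have "v \<notin> W"
      using v' by (auto simp: W_def)
    moreover have "W \<subseteq> V"
      by (auto simp: W_def)
    ultimately have "W \<subset> V"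
      using v' by blast
    then have "dim W < dim V"
      using V(1) subW by (metis dim_psubset span_eq_iff)
    moreover have "f ` W \<subseteq> W" "g ` W \<subseteq> W"
      using V v v' by (auto simp: W_def f(2)[symmetric] g(2)[symmetric])
    ultimately obtain B where B: "pairwise orthogonal B" "\<forall>b\<in>B. norm b = 1" "span B = W"
      "\<forall>b\<in>B. \<exists>c d. f b = c *\<^sub>R b \<and> g b = d *\<^sub>R b"
      using less.hyps[of W] subW by blast
    have BW: "B \<subseteq> W"
      using B(3) span_superset by blast
    have "span (insert v B) = V"
    proof
      show "span (insert v B) \<subseteq> V"
        using V(1) v' BW by (intro span_minimal) (auto simp: W_def)
      show "V \<subseteq> span (insert v B)"
      proof
        fix x assume "x \<in> V"
        then have "x - (v \<bullet> x) *\<^sub>R v \<in> W"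
          using v' V(1) by (auto simp: W_def inner_diff subspace_diff subspace_scale)
        then show "x \<in> span (insert v B)"
          using B(3) span_breakdown_eq by blast
      qed
    qed
    moreover have "pairwise orthogonal (insert v B)"
      using B(1) BW by (auto simp: pairwise_insert W_def orthogonal_def inner_commute)
    ultimately show ?thesis
      using B v v' by (intro exI[of _ "insert v B"]) auto
  qed
qed

lemma inner_orthonormal_sum:
  assumes "pairwise orthogonal B" "\<And>b. b \<in> B \<Longrightarrow> norm b = 1" "finite B" "b \<in> B"
  shows "(\<Sum>i\<in>B. w i *\<^sub>R i) \<bullet> b = w b"
proof -
  have "(\<Sum>i\<in>B. w i *\<^sub>R i) \<bullet> b = (\<Sum>i\<in>B. if i = b then w i else 0)"
    unfolding inner_sum_left using assms
    by (intro sum.cong) (auto simp: pairwise_def orthogonal_def simp flip: power2_norm_eq_inner)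
  then show ?thesis
    using assms by simp
qed

text \<open>The weights are squared coordinates, which sum to 1 for a unit vector. Values of the
  form are then convex combinations of the eigenvalues.\<close>

lemma quadratic_form_eigenbasis:
  fixes f :: "'a::euclidean_space \<Rightarrow> 'a"
  assumes B: "pairwise orthogonal B" "\<And>b. b \<in> B \<Longrightarrow> norm b = 1" "finite B" "span B = UNIV"
    and f: "linear f" "\<And>b. b \<in> B \<Longrightarrow> f b = c b *\<^sub>R b"
  shows "x \<bullet> f x = (\<Sum>b\<in>B. (x \<bullet> b)\<^sup>2 * c b)"
proof -
  interpret linear f by fact
  have x: "(\<Sum>b\<in>B. (x \<bullet> b) *\<^sub>R b) = x"
    using B by (intro orthonormal_basis_expand) auto
  have "f x = f (\<Sum>b\<in>B. (x \<bullet> b) *\<^sub>R b)"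
    by (simp only: x)
  also have "\<dots> = (\<Sum>b\<in>B. (x \<bullet> b) *\<^sub>R c b *\<^sub>R b)"
    using f(2) by (simp add: sum scaleR)
  finally show ?thesis
    by (simp add: inner_sum_right power2_eq_square algebra_simps)
qed

section \<open>Normal matrices\<close>

text \<open>A complex eigenvector is split into its real part \<open>x\<close> and imaginary part \<open>y\<close>.\<close>

lemma eigenvalues_iff_real:
  fixes A :: "real^'n^'n"
  shows "l \<in> eigenvalues A \<longleftrightarrow> (\<exists>x y. (x \<noteq> 0 \<or> y \<noteq> 0) \<and>
    A *v x = Re l *\<^sub>R x - Im l *\<^sub>R y \<and> A *v y = Im l *\<^sub>R x + Re l *\<^sub>R y)"
proof -
  have *: "map_matrix of_real A *v v = l *s v \<longleftrightarrow>
      A *v (\<chi> i. Re (v $ i)) = Re l *\<^sub>R (\<chi> i. Re (v $ i)) - Im l *\<^sub>R (\<chi> i. Im (v $ i)) \<and>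
      A *v (\<chi> i. Im (v $ i)) = Im l *\<^sub>R (\<chi> i. Re (v $ i)) + Re l *\<^sub>R (\<chi> i. Im (v $ i))"
    for v :: "complex^'n"
    by (auto simp: vec_eq_iff matrix_vector_mult_def map_matrix_def complex_eq_iff add.commute)
  have nz: "v \<noteq> 0 \<longleftrightarrow> (\<chi> i. Re (v $ i)) \<noteq> 0 \<or> (\<chi> i. Im (v $ i)) \<noteq> 0" for v :: "complex^'n"
    by (auto simp: vec_eq_iff complex_eq_iff)
  show ?thesis
  proof
    assume "l \<in> eigenvalues A"
    then show "\<exists>x y. (x \<noteq> 0 \<or> y \<noteq> 0) \<and>
      A *v x = Re l *\<^sub>R x - Im l *\<^sub>R y \<and> A *v y = Im l *\<^sub>R x + Re l *\<^sub>R y"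
      unfolding eigenvalues_def mem_Collect_eq * nz by blast
  next
    assume "\<exists>x y. (x \<noteq> 0 \<or> y \<noteq> 0) \<and>
      A *v x = Re l *\<^sub>R x - Im l *\<^sub>R y \<and> A *v y = Im l *\<^sub>R x + Re l *\<^sub>R y"
    then obtain x y where "(x \<noteq> 0 \<or> y \<noteq> 0) \<and>
      A *v x = Re l *\<^sub>R x - Im l *\<^sub>R y \<and> A *v y = Im l *\<^sub>R x + Re l *\<^sub>R y"
      by blast
    then show "l \<in> eigenvalues A"
      unfolding eigenvalues_def mem_Collect_eq * nz
      by (intro exI[of _ "\<chi> i. Complex (x $ i) (y $ i)"]) simp
  qed
qed

section \<open>Transposes and the scaled relative graph in the chart\<close>

lemma inner_transpose:
  fixes A :: "real^'n^'m"
  shows "(transpose A *v x) \<bullet> y = x \<bullet> (A *v y)"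
  by (simp add: dot_lmul_matrix)

lemma inner_transpose':
  fixes A :: "real^'n^'m"
  shows "(A *v x) \<bullet> y = x \<bullet> (transpose A *v y)"
  by (metis inner_commute inner_transpose)

lemma linear_gram:
  fixes A :: "real^'n^'m"
  shows "linear (\<lambda>x. transpose A *v (A *v x))"
  unfolding matrix_vector_mul_assoc by (rule matrix_vector_mul_linear)

text \<open>The joint numerical range of the symmetric part of \<open>A\<close> and of
  \<open>transpose A ** A\<close>, with the two values stored as one complex number.\<close>

definition numerical_shadow :: "real^'n^'n \<Rightarrow> complex set" where
  "numerical_shadow A = {Complex (x \<bullet> (A *v x)) ((norm (A *v x))\<^sup>2) | x. norm x = 1}"

text \<open>For unit \<open>x\<close> the modulus is \<open>norm (A *v x)\<close>, and multiplying
  it by the cosine of the angle gives the inner product.\<close>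

lemma chart_srg_point:
  assumes "norm x = 1"
  shows "chart (srg_point A x) = Complex (x \<bullet> (A *v x)) ((norm (A *v x))\<^sup>2)"
proof (cases "A *v x = 0")
  case True
  then show ?thesis
    by (simp add: srg_point_def chart_def complex_eq_iff)
next
  case False
  define y where "y = A *v x"
  define t where "t = vec_angle y x"
  have y: "y \<noteq> 0" "x \<noteq> 0"
    using False assms by (auto simp: y_def)
  have t: "t = arccos ((y \<bullet> x) / norm y)"
    using y assms by (simp add: t_def vec_angle_def)
  have "\<bar>(y \<bullet> x) / norm y\<bar> \<le> 1"
    using Cauchy_Schwarz_ineq2[of y x] assms y by (simp add: field_simps)
  then have b: "- 1 \<le> (y \<bullet> x) / norm y" "(y \<bullet> x) / norm y \<le> 1"
    unfolding abs_le_iff by linarith+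
  have cos: "norm y * cos t = y \<bullet> x"
    unfolding t cos_arccos[OF b] using y by simp
  \<comment> \<open>The angle lies between 0 and \<open>pi\<close>, so the point is in the upper
    half-plane and \<open>chart_upper\<close> applies.\<close>
  have "0 \<le> sin t"
    unfolding t using b by (intro sin_ge_zero arccos_lbound arccos_ubound)
  have z: "srg_point A x = of_real (norm y) * cis t"
    using assms by (simp add: srg_point_def y_def t_def cis_conv_exp)
  have "chart (srg_point A x) = Complex (norm y * cos t) ((norm y)\<^sup>2)"
    using \<open>0 \<le> sin t\<close> by (subst chart_upper) (auto simp: z norm_mult)
  then show ?thesis
    unfolding cos by (simp add: inner_commute y_def)
qed

lemma srg_point_scaleR:
  assumes "c > 0"
  shows "srg_point A (c *\<^sub>R x) = srg_point A x"
  using assms by (simp add: srg_point_def vec_angle_def matrix_vector_mult_scaleR)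

lemma chart_upper_srg: "chart ` upper_srg A = numerical_shadow A"
proof -
  have "upper_srg A = srg_point A ` {x. norm x = 1}"
  proof -
    have "srg_point A x \<in> srg_point A ` {x. norm x = 1}" if "x \<noteq> 0" for x
      using that srg_point_scaleR[of "inverse (norm x)" A x]
      by (intro image_eqI[of _ _ "x /\<^sub>R norm x"]) auto
    moreover have "x \<noteq> 0" if "norm x = 1" for x :: "real^'a"
      using that by auto
    ultimately show ?thesis
      by (auto simp: upper_srg_def)
  qed
  then show ?thesis
    by (auto simp: numerical_shadow_def chart_srg_point image_image Setcompr_eq_image)
qed

section \<open>Eigenvalues of a normal matrix as points of the shadow\<close>

context
  fixes A :: "real^'n^'n"
  assumes normal: "transpose A ** A = A ** transpose A"
begin

lemma normal_commute: "transpose A *v (A *v x) = A *v (transpose A *v x)"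
  by (simp only: matrix_vector_mul_assoc normal)

lemma normal_norm: "(transpose A *v x) \<bullet> (transpose A *v x) = (A *v x) \<bullet> (A *v x)"
  by (metis inner_commute inner_transpose normal_commute)

text \<open>With \<open>v = x + i y\<close> and \<open>l = a + i b\<close>, this is the real form of
  the classical fact that an eigenvector \<open>v\<close> of a normal matrix for \<open>l\<close> is
  one of its adjoint for \<open>conj l\<close>.\<close>

lemma normal_transpose_eigen:
  assumes x: "A *v x = a *\<^sub>R x - b *\<^sub>R y" and y: "A *v y = b *\<^sub>R x + a *\<^sub>R y"
  shows "transpose A *v x = a *\<^sub>R x + b *\<^sub>R y" "transpose A *v y = a *\<^sub>R y - b *\<^sub>R x"
proof -
  define p where "p = transpose A *v x"
  define q where "q = transpose A *v y"
  have p2: "p \<bullet> p = (a *\<^sub>R x - b *\<^sub>R y) \<bullet> (a *\<^sub>R x - b *\<^sub>R y)"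
    and q2: "q \<bullet> q = (b *\<^sub>R x + a *\<^sub>R y) \<bullet> (b *\<^sub>R x + a *\<^sub>R y)"
    unfolding p_def q_def normal_norm x y by simp_all
  have pq: "p \<bullet> x = x \<bullet> (a *\<^sub>R x - b *\<^sub>R y)" "p \<bullet> y = x \<bullet> (b *\<^sub>R x + a *\<^sub>R y)"
    "q \<bullet> x = y \<bullet> (a *\<^sub>R x - b *\<^sub>R y)" "q \<bullet> y = y \<bullet> (b *\<^sub>R x + a *\<^sub>R y)"
    unfolding p_def q_def inner_transpose x y by simp_all
  \<comment> \<open>The squared norm of the adjoint applied to \<open>v\<close> minus
    \<open>conj l\<close> times \<open>v\<close>. Normality evaluates the squares and transposition
    the mixed terms.\<close>
  have "(p - (a *\<^sub>R x + b *\<^sub>R y)) \<bullet> (p - (a *\<^sub>R x + b *\<^sub>R y))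
      + (q - (a *\<^sub>R y - b *\<^sub>R x)) \<bullet> (q - (a *\<^sub>R y - b *\<^sub>R x)) =
      p \<bullet> p + q \<bullet> q - 2 * (a * (p \<bullet> x) + b * (p \<bullet> y)) - 2 * (a * (q \<bullet> y) - b * (q \<bullet> x))
      + (a\<^sup>2 + b\<^sup>2) * (x \<bullet> x + y \<bullet> y)"
    by (simp add: inner_diff inner_add inner_commute power2_eq_square algebra_simps)
  also have "\<dots> = 0"
    unfolding p2 q2 pq
    by (simp add: inner_diff inner_add inner_commute power2_eq_square algebra_simps)
  finally have "p - (a *\<^sub>R x + b *\<^sub>R y) = 0 \<and> q - (a *\<^sub>R y - b *\<^sub>R x) = 0"
    by (metis add_nonneg_eq_0_iff inner_eq_zero_iff inner_ge_zero)
  then show "transpose A *v x = a *\<^sub>R x + b *\<^sub>R y" "transpose A *v y = a *\<^sub>R y - b *\<^sub>R x"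
    by (simp_all add: p_def q_def)
qed

text \<open>The normalized real part \<open>x\<close> of the eigenvector attains the point: the
  mixed terms in \<open>x\<close> and \<open>y\<close> cancel between \<open>A\<close> and its
  transpose, and \<open>x\<close> is an eigenvector of \<open>transpose A ** A\<close>.\<close>

lemma eigenpoint_in_shadow_aux:
  assumes x: "A *v x = a *\<^sub>R x - b *\<^sub>R y" and y: "A *v y = b *\<^sub>R x + a *\<^sub>R y" and "x \<noteq> 0"
  shows "Complex a (a\<^sup>2 + b\<^sup>2) \<in> numerical_shadow A"
proof -
  note tr = normal_transpose_eigen[OF x y]
  have "x \<bullet> (A *v x) + (transpose A *v x) \<bullet> x = 2 * a * (x \<bullet> x)"
    unfolding tr x by (simp add: inner_diff inner_add inner_commute)
  then have 1: "x \<bullet> (A *v x) = a * (x \<bullet> x)"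
    by (simp only: inner_transpose)
  have "transpose A *v (A *v x) = (a\<^sup>2 + b\<^sup>2) *\<^sub>R x"
    unfolding x matrix_vector_mult_diff_distrib matrix_vector_mult_scaleR tr
    by (simp add: algebra_simps power2_eq_square)
  then have 2: "(A *v x) \<bullet> (A *v x) = (a\<^sup>2 + b\<^sup>2) * (x \<bullet> x)"
    by (metis inner_commute inner_scaleR_right inner_transpose)
  define u where "u = x /\<^sub>R norm x"
  have xx: "x \<bullet> x = norm x * norm x"
    by (simp add: power2_eq_square flip: power2_norm_eq_inner)
  have u: "(c *\<^sub>R x) \<bullet> (A *v (c *\<^sub>R x)) = c\<^sup>2 * (x \<bullet> (A *v x))"
    "(norm (A *v (c *\<^sub>R x)))\<^sup>2 = c\<^sup>2 * ((A *v x) \<bullet> (A *v x))" for c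
    by (simp_all only: matrix_vector_mult_scaleR power2_norm_eq_inner inner_scaleR_left
        inner_scaleR_right) (simp_all add: power2_eq_square)
  have "(inverse (norm x))\<^sup>2 * (x \<bullet> x) = 1"
    using \<open>x \<noteq> 0\<close> by (simp add: xx power2_eq_square field_simps)
  then have "u \<bullet> (A *v u) = a" "(norm (A *v u))\<^sup>2 = a\<^sup>2 + b\<^sup>2"
    unfolding u_def u 1 2 by (simp_all add: mult.left_commute)
  moreover have "norm u = 1"
    using \<open>x \<noteq> 0\<close> by (simp add: u_def)
  ultimately show ?thesis
    unfolding numerical_shadow_def mem_Collect_eq by (intro exI[of _ u]) simp
qed

lemma eigenvalue_in_shadow:
  assumes "l \<in> eigenvalues A"
  shows "Complex (Re l) ((cmod l)\<^sup>2) \<in> numerical_shadow A"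
proof -
  obtain x y where xy: "x \<noteq> 0 \<or> y \<noteq> 0" "A *v x = Re l *\<^sub>R x - Im l *\<^sub>R y"
    "A *v y = Im l *\<^sub>R x + Re l *\<^sub>R y"
    using assms eigenvalues_iff_real by blast
  show ?thesis
  proof (cases "x = 0")
    case False
    then show ?thesis
      using eigenpoint_in_shadow_aux[OF xy(2,3)] by (simp add: cmod_power2)
  next
    case True
    \<comment> \<open>Multiplying the eigenvector \<open>x + i y\<close> by \<open>-i\<close> gives
      \<open>y - i x\<close>, whose real part is nonzero.\<close>
    have "A *v y = Re l *\<^sub>R y - Im l *\<^sub>R (- x)" "A *v (- x) = Im l *\<^sub>R y + Re l *\<^sub>R (- x)"
      using xy True by auto
    then show ?thesis
      using eigenpoint_in_shadow_aux[of y "Re l" "Im l" "- x"] True xy(1) by (simp add: cmod_power2)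
  qed
qed

text \<open>The vector \<open>b\<close> is annihilated by the polynomial
  \<open>X^2 - 2 h X + q\<close> in \<open>A\<close>. Its root in the upper half-plane has real part
  \<open>h\<close> and squared modulus \<open>q\<close>, and is an eigenvalue.\<close>

lemma common_eigenvector_eigenvalue:
  assumes b: "norm b = 1" and h: "A *v b + transpose A *v b = (2 * h) *\<^sub>R b"
    and q: "transpose A *v (A *v b) = q *\<^sub>R b"
  shows "Complex h q \<in> chart ` (eigenvalues A \<inter> upper_half_plane)"
proof -
  have bb: "b \<bullet> b = 1"
    using b by (simp flip: power2_norm_eq_inner)
  have "b \<bullet> (A *v b) + (transpose A *v b) \<bullet> b = 2 * h"
    by (metis h bb inner_add_right inner_commute inner_scaleR_right mult.right_neutral)
  then have h': "b \<bullet> (A *v b) = h"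
    by (simp only: inner_transpose)
  have q': "(norm (A *v b))\<^sup>2 = q"
    by (metis q bb inner_commute inner_scaleR_right inner_transpose mult.right_neutral power2_norm_eq_inner)
  \<comment> \<open>Cauchy-Schwarz makes the discriminant nonpositive, so \<open>s\<close> below is
    a genuine square root.\<close>
  have hq: "h\<^sup>2 \<le> q"
    using Cauchy_Schwarz_ineq[of b "A *v b"] bb by (simp add: h' flip: q' power2_norm_eq_inner)
  define s where "s = sqrt (q - h\<^sup>2)"
  have s: "s \<ge> 0" "s\<^sup>2 = q - h\<^sup>2"
    using hq by (auto simp: s_def)
  have AA: "A *v (A *v b) = (2 * h) *\<^sub>R (A *v b) - q *\<^sub>R b"
  proof -
    have "A *v (A *v b + transpose A *v b) = (2 * h) *\<^sub>R (A *v b)"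
      by (simp only: h matrix_vector_mult_scaleR)
    then show ?thesis
      by (simp only: matrix_vector_right_distrib normal_commute[symmetric] q eq_diff_eq)
  qed
  have "Complex h s \<in> eigenvalues A"
  \<comment> \<open>In the first case the candidate \<open>(A - conj l) b\<close> is zero, and
    \<open>b\<close> itself is an eigenvector for the real number \<open>h\<close>.\<close>
  proof (cases "A *v b - h *\<^sub>R b = 0 \<and> s = 0")
    case True
    then show ?thesis
      unfolding eigenvalues_iff_real using b by (intro exI[of _ b] exI[of _ 0]) auto
  next
    case False
    \<comment> \<open>the complex vector \<open>(A - conj l) b\<close>, on which \<open>A\<close> acts as \<open>l\<close> since
      \<open>(A - l) (A - conj l) b = 0\<close>\<close>
    have "A *v (A *v b - h *\<^sub>R b) = h *\<^sub>R (A *v b - h *\<^sub>R b) - s *\<^sub>R s *\<^sub>R b"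
      using s(2) unfolding matrix_vector_mult_diff_distrib matrix_vector_mult_scaleR AA
      by (simp add: algebra_simps flip: power2_eq_square scaleR_add_left)
    moreover have "A *v (s *\<^sub>R b) = s *\<^sub>R (A *v b - h *\<^sub>R b) + h *\<^sub>R s *\<^sub>R b"
      by (simp add: matrix_vector_mult_scaleR algebra_simps)
    moreover have "A *v b - h *\<^sub>R b \<noteq> 0 \<or> s *\<^sub>R b \<noteq> 0"
      using False b by auto
    ultimately show ?thesis
      unfolding eigenvalues_iff_real
      by (intro exI[of _ "A *v b - h *\<^sub>R b"] exI[of _ "s *\<^sub>R b"]) simp
  qed
  moreover have "chart (Complex h s) = Complex h q"
    using s by (simp add: chart_upper cmod_power2)
  ultimately show ?thesis
    using s(1) by (intro image_eqI[of _ _ "Complex h s"]) (auto simp: upper_half_plane_def)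
qed

section \<open>The shadow as a convex hull\<close>

lemma normal_eigenbasis:
  obtains B h q where "pairwise orthogonal B" "\<And>b. b \<in> B \<Longrightarrow> norm b = 1" "finite B"
    "span B = (UNIV :: (real^'n) set)"
    "\<And>b. b \<in> B \<Longrightarrow> A *v b + transpose A *v b = (2 * h b) *\<^sub>R b"
    "\<And>b. b \<in> B \<Longrightarrow> transpose A *v (A *v b) = q b *\<^sub>R b"
proof -
  let ?f = "\<lambda>x. A *v x + transpose A *v x" and ?g = "\<lambda>x. transpose A *v (A *v x)"
  have "\<exists>B. pairwise orthogonal B \<and> (\<forall>b\<in>B. norm b = 1) \<and> span B = (UNIV :: (real^'n) set) \<and>
           (\<forall>b\<in>B. \<exists>c d. ?f b = c *\<^sub>R b \<and> ?g b = d *\<^sub>R b)"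
  proof (rule commuting_self_adjoint_eigenbasis)
    show "linear ?f"
      by (intro linear_compose_add matrix_vector_mul_linear)
    show "linear ?g"
      by (rule linear_gram)
    show "?f x \<bullet> y = x \<bullet> ?f y" "?g x \<bullet> y = x \<bullet> ?g y" for x y
      by (simp_all only: inner_add_left inner_add_right inner_transpose' transpose_transpose add.commute)
    show "?f (?g x) = ?g (?f x)" for x
      by (simp only: matrix_vector_right_distrib normal_commute)
  qed auto
  then obtain B where B: "pairwise orthogonal B" "\<forall>b\<in>B. norm b = 1" "span B = (UNIV :: (real^'n) set)"
    and ev: "\<forall>b\<in>B. \<exists>c d. ?f b = c *\<^sub>R b \<and> ?g b = d *\<^sub>R b"
    by blast
  from ev obtain c d where cd: "\<And>b. b \<in> B \<Longrightarrow> ?f b = c b *\<^sub>R b \<and> ?g b = d b *\<^sub>R b"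
    by metis
  have "finite B"
    using B by (intro independent_imp_finite pairwise_orthogonal_independent) auto
  with B cd show thesis
    by (intro that[of B "\<lambda>b. c b / 2" d]) auto
qed

text \<open>Each shadow point averages the points \<open>(h b, q b)\<close>, which come from
  eigenvalues. The reverse inclusion holds because the shadow is convex and contains the eigenvalue
  points.\<close>

lemma shadow_eq_convex_hull:
  "numerical_shadow A = convex hull (chart ` (eigenvalues A \<inter> upper_half_plane))"
proof -
  obtain B h q where B: "pairwise orthogonal B" "\<And>b. b \<in> B \<Longrightarrow> norm b = 1" "finite B"
    "span B = (UNIV :: (real^'n) set)"
    and h: "\<And>b. b \<in> B \<Longrightarrow> A *v b + transpose A *v b = (2 * h b) *\<^sub>R b"
    and q: "\<And>b. b \<in> B \<Longrightarrow> transpose A *v (A *v b) = q b *\<^sub>R b"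
    by (rule normal_eigenbasis) blast
  have hx: "x \<bullet> (A *v x) = (\<Sum>b\<in>B. (x \<bullet> b)\<^sup>2 * h b)" for x
  proof -
    have "x \<bullet> (A *v x + transpose A *v x) = (\<Sum>b\<in>B. (x \<bullet> b)\<^sup>2 * (2 * h b))"
      using B h by (intro quadratic_form_eigenbasis linear_compose_add matrix_vector_mul_linear) auto
    also have "\<dots> = 2 * (\<Sum>b\<in>B. (x \<bullet> b)\<^sup>2 * h b)"
      by (simp add: sum_distrib_left algebra_simps)
    finally show ?thesis
      using inner_transpose'[of A x x] inner_commute[of x "A *v x"]
      unfolding inner_add_right by linarith
  qed
  have qx: "(norm (A *v x))\<^sup>2 = (\<Sum>b\<in>B. (x \<bullet> b)\<^sup>2 * q b)" for x
  proof -
    have "x \<bullet> (transpose A *v (A *v x)) = (\<Sum>b\<in>B. (x \<bullet> b)\<^sup>2 * q b)"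
      using B q by (intro quadratic_form_eigenbasis linear_gram) auto
    then show ?thesis
      by (metis inner_commute inner_transpose power2_norm_eq_inner)
  qed
  \<comment> \<open>Parseval's identity, as the case of the identity map with all eigenvalues
    1.\<close>
  have nx: "(norm x)\<^sup>2 = (\<Sum>b\<in>B. (x \<bullet> b)\<^sup>2)" for x
    using quadratic_form_eigenbasis[OF B linear_ident, of "\<lambda>_. 1" x]
    by (simp add: power2_norm_eq_inner)
  define pt where "pt x = (\<Sum>b\<in>B. (x \<bullet> b)\<^sup>2 *\<^sub>R Complex (h b) (q b))" for x :: "real^'n"
  have pt: "Complex (x \<bullet> (A *v x)) ((norm (A *v x))\<^sup>2) = pt x" for x
    by (simp add: pt_def complex_eq_iff hx qx)
  have shadow: "numerical_shadow A = {pt x | x. norm x = 1}"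
    by (simp add: numerical_shadow_def pt)
  have "pt x \<in> convex hull (chart ` (eigenvalues A \<inter> upper_half_plane))" if "norm x = 1" for x
    unfolding pt_def
  proof (intro convex_sum hull_inc)
    show "Complex (h b) (q b) \<in> chart ` (eigenvalues A \<inter> upper_half_plane)" if "b \<in> B" for b
      using B h q that common_eigenvector_eigenvalue by blast
  qed (use B that nx[of x] in auto)
  moreover have "convex (numerical_shadow A)"
    unfolding shadow
  proof (rule convexI, clarify)
    fix u v :: real and x y :: "real^'n"
    assume uv: "0 \<le> u" "0 \<le> v" "u + v = 1" and xy: "norm x = 1" "norm y = 1"
    \<comment> \<open>Only squared coordinates enter \<open>pt\<close>. Mixing those of
      \<open>x\<close> and \<open>y\<close> and taking square roots gives the coordinates of a unit
      vector that attains the convex combination.\<close>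
    define w where "w b = u * (x \<bullet> b)\<^sup>2 + v * (y \<bullet> b)\<^sup>2" for b
    define z where "z = (\<Sum>b\<in>B. sqrt (w b) *\<^sub>R b)"
    have z: "(z \<bullet> b)\<^sup>2 = w b" if "b \<in> B" for b
      unfolding z_def using B that uv by (subst inner_orthonormal_sum) (auto simp: w_def)
    have "(norm z)\<^sup>2 = u * (norm x)\<^sup>2 + v * (norm y)\<^sup>2"
      unfolding nx using z by (simp add: w_def sum.distrib sum_distrib_left)
    then have "norm z = 1"
      using uv xy by (simp add: power2_eq_1_iff) (smt (verit) norm_ge_zero)
    moreover have "u *\<^sub>R pt x + v *\<^sub>R pt y = pt z"
      unfolding pt_def using z by (simp add: w_def scaleR_right.sum sum.distrib algebra_simps)
    ultimately show "\<exists>z. u *\<^sub>R pt x + v *\<^sub>R pt y = pt z \<and> norm z = 1"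
      by blast
  qed
  moreover have "chart ` (eigenvalues A \<inter> upper_half_plane) \<subseteq> numerical_shadow A"
    using eigenvalue_in_shadow by (auto simp: chart_upper upper_half_plane_def)
  ultimately show ?thesis
    by (intro equalityI hull_minimal) (auto simp: shadow)
qed

end

theorem theorem4p3:
  fixes A :: "real^'n^'n"
  assumes "transpose A ** A = A ** transpose A"
  shows "upper_srg A = arc_poly (eigenvalues A \<inter> upper_half_plane)"
proof -
  have "chart ` upper_srg A = chart ` arc_poly (eigenvalues A \<inter> upper_half_plane)"
    by (simp add: chart_upper_srg shadow_eq_convex_hull[OF assms] chart_arc_poly)
  then show ?thesis
    by (simp add: inj_image_eq_iff inj_chart)
qed

end
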